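(* Let $0<p<1$, $0<\lambda\le 1$, and let $f\in\mathcal{V}_p(\lambda)$ have the Taylor expansion $f(z)=z+\sum_{n=2}^{\infty}a_n(f)z^n$ for $|z|<p$. Then the inequality $$|a_n(f)|\le \frac{1-(\lambda p^2)^n}{p^{n-1}(1-\lambda p^2)}$$ holds in each of the following cases: for $n=3$ if $p\in(0,1/2]$; for $n=4$ if $p\in(0,(\sqrt3-1)/2]$; and for $n=5$ if $p\in(0,(\sqrt5-1)/4]$. Equality holds in this inequality for the function $$k_p^{\lambda}(z)=\frac{-pz}{(z-p)(1-\lambda p z)}.$$
   Context: $\mathbb{D}=\{z\in\mathbb{C}:|z|<1\}$. For $p\in(0,1)$, $\mathcal{A}(p)$ is the class of functions $f$ on $\mathbb{D}$ that are analytic in $\mathbb{D}\setminus\{p\}$, have a simple pole at $z=p$, and satisfy $f(0)=0=f'(0)-1$. For $f\in\mathcal{A}(p)$ set $U_f(z)=\left(\frac{z}{f(z)}\right)^2 f'(z)-1$ (with removable singularities, at $z=0$ and $z=p$, removed). For $0<\lambda\le 1$, $\mathcal{V}_p(\lambda)=\{f\in\mathcal{A}(p): |U_f(z)|<\lambda \text{ for all } z\in\mathbb{D}\}$. Each $f\in\mathcal{V}_p(\lambda)$ is analytic in the disc $|z|<p$, so it has a Taylor expansion there about $0$, whose coefficients are denoted $a_n(f)$. *)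

theory Defs
  imports "HOL-Complex_Analysis.Complex_Analysis"
begin

(* Functions are total on the complex plane; only the values on the unit disc minus the pole
   matter, and the value at p itself is irrelevant. *)
definition class_A :: "real \<Rightarrow> (complex \<Rightarrow> complex) set" where
  "class_A p = {f. f analytic_on (ball 0 1 - {of_real p}) \<and>
                   is_pole f (of_real p) \<and> zorder f (of_real p) = -1 \<and>
                   f 0 = 0 \<and> deriv f 0 = 1}"

(* For f in class_A p, the quotient has removable singularities at 0 and at p. At any further
   zero of f in the disc it has a genuine pole; there remove_sings returns the value 0, but the
   function is unbounded on every punctured neighbourhood, so such f do not belong to class_V. *)
definition U_op :: "(complex \<Rightarrow> complex) \<Rightarrow> complex \<Rightarrow> complex" where
  "U_op f = remove_sings (\<lambda>z. (z / f z)\<^sup>2 * deriv f z - 1)"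

definition class_V :: "real \<Rightarrow> real \<Rightarrow> (complex \<Rightarrow> complex) set" where
  "class_V p lam = {f \<in> class_A p. \<forall>z\<in>ball 0 1. norm (U_op f z) < lam}"

definition taylor_coeff :: "(complex \<Rightarrow> complex) \<Rightarrow> nat \<Rightarrow> complex" where
  "taylor_coeff f n = fps_nth (fps_expansion f 0) n"

definition k_fun :: "real \<Rightarrow> real \<Rightarrow> complex \<Rightarrow> complex" where
  "k_fun p lam z = - of_real p * z / ((z - of_real p) * (1 - of_real lam * of_real p * z))"

definition coeff_bound :: "real \<Rightarrow> real \<Rightarrow> nat \<Rightarrow> real" where
  "coeff_bound p lam n = (1 - (lam * p\<^sup>2) ^ n) / (p ^ (n - 1) * (1 - lam * p\<^sup>2))"

end

(* Writing 1/f = H(z)/z, the hypothesis on U_f says that U_f = lam z^2 w(z) with |w| <= 1, and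
   (1/f)' = -(1 + U_f)/z^2 together with 1/f(p) = 0 integrates to
   H(z) = (1 - z/p) (1 - lam p z B(z)), where -B(z) is the mean of w over the segment from p to z;
   in particular |B| <= 1. Hence f has the Taylor coefficients of a product of geometric series in
   z/p and lam p z B(z), and the classical estimates |b_k| <= 1 - |b_0|^2 for the coefficients of B
   bound |a_n| by a polynomial in |b_0|, which for the stated ranges of p is largest at |b_0| = 1. *)

theory Submission
  imports Defs
begin

text \<open>Comparing coefficients in f^2 (1 + U_f) = z^2 f' shows that U_f vanishes doubly at 0.
  Hence (1/f)' = -1/z^2 - lam w has no 1/z term, and with a primitive P of w the function 1/f has
  the form 1/z - lam P + const throughout the disc without 0 and p. The constant, which carries a_2,
  is fixed by the pole: 1/f must tend to 0 at p. The same condition lets the factor 1 - z/p split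
  off. The majorant is compared with its value at |b_0| = 1 separately for each power of lam p. The
  coefficient of the first power in the difference contains the factor 1 - |b_0|; with q = 1/p, the
  remaining factor at |b_0| = 1 is q - 2 for n = 3 and q^2 - 2 q - 2 for n = 4, whence the ranges of
  p in these cases. The value at |b_0| = 1 is the coefficient of the extremal function, for which B
  = 1.\<close>

subsection \<open>Coefficients of functions bounded by one\<close>

text \<open>Cauchy's inequality is available on circles of radius r < 1 only, since nothing is known
  on the unit circle; letting r tend to 1 removes the loss.\<close>

lemma fps_nth_bounded_le_1:
  assumes "B holomorphic_on ball 0 1" "\<And>z. z \<in> ball 0 1 \<Longrightarrow> norm (B z) \<le> 1"
    and "B has_fps_expansion F"
  shows "norm (fps_nth F n) \<le> 1"
proof -
  have bound: "norm (fps_nth F n) \<le> 1 / r ^ n" if r: "0 < r" "r < 1" for r :: real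
  proof -
    have "norm ((deriv ^^ n) B 0) \<le> fact n * 1 / r ^ n"
    proof (rule Cauchy_inequality)
      show "B holomorphic_on ball 0 r"
        using assms(1) r by (auto intro: holomorphic_on_subset)
      show "continuous_on (cball 0 r) B"
        using r by (intro holomorphic_on_imp_continuous_on holomorphic_on_subset[OF assms(1)]) auto
    qed (use r assms(2) in auto)
    then show ?thesis
      by (simp add: fps_nth_fps_expansion[OF assms(3)] norm_divide field_simps)
  qed
  have "((\<lambda>r::real. 1 / r ^ n) \<longlongrightarrow> 1 / 1 ^ n) (at_left 1)"
    by (intro tendsto_intros) auto
  moreover have "eventually (\<lambda>r. norm (fps_nth F n) \<le> 1 / r ^ n) (at_left (1::real))"
    using eventually_at_left_real[of 0 "1::real"] by (auto elim!: eventually_mono intro!: bound)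
  ultimately show ?thesis
    by (metis tendsto_lowerbound power_one div_by_1 trivial_limit_at_left_real)
qed

text \<open>The sum is geometric in a k-th root of unity \<open>w\<close>. It would have ratio 1
  only if k divided n, which 0 < n < k excludes.\<close>

lemma sum_root_unity_powers:
  assumes "0 < n" "n < k"
  shows "(\<Sum>j<k. (cis (2 * pi / k) ^ j) ^ n) = 0"
proof -
  define w where "w = cis (2 * pi / k) ^ n"
  have "w \<noteq> 1"
  proof
    assume "w = 1"
    then have "cis (2 * pi * n / k) = 1"
      unfolding w_def Complex.DeMoivre by (simp add: mult_ac)
    then have "cos (2 * pi * n / k) = 1"
      by (metis cis.sel(1) one_complex.sel(1))
    then obtain m :: int where "2 * pi * n / k = m * (2 * pi)"
      using cos_one_2pi_int by auto
    then have "real n = m * real k"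
      using assms by (simp add: field_simps)
    then have "int n = m * int k"
      by (metis (mono_tags) of_int_eq_iff of_int_mult of_int_of_nat_eq)
    then have "int k dvd int n" by simp
    with assms show False
      by (auto dest: dvd_imp_le)
  qed
  moreover have "w ^ k = 1"
  proof -
    have "w ^ k = (cis (2 * pi / k) ^ k) ^ n"
      by (simp add: w_def power_mult [symmetric] mult.commute)
    also have "cis (2 * pi / k) ^ k = 1"
      using assms unfolding Complex.DeMoivre by simp
    finally show ?thesis by simp
  qed
  ultimately have "(\<Sum>j<k. w ^ j) = 0"
    by (simp add: geometric_sum)
  then show ?thesis
    by (simp add: w_def power_mult [symmetric] mult.commute)
qed

text \<open>Averaging \<open>B\<close> over rotations by the \<open>k\<close>-th roots of unity removes the coefficients strictly
  between \<open>0\<close> and \<open>k\<close>; after a Moebius map sending the constant term to \<open>0\<close>, the \<open>k\<close>-th coefficient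
  is simply divided by \<open>1 - |b\<^sub>0|\<^sup>2\<close>.\<close>
lemma fps_nth_strictly_bounded_le:
  assumes hol: "B holomorphic_on ball 0 1" and less: "\<And>z. z \<in> ball 0 1 \<Longrightarrow> norm (B z) < 1"
    and exp: "B has_fps_expansion F" and "k > 0"
  shows "norm (fps_nth F k) \<le> 1 - (norm (fps_nth F 0))\<^sup>2"
proof -
  define w where "w = cis (2 * pi / k)"
  have nw [simp]: "norm (w ^ j * z) = norm z" for z j
    by (simp add: w_def norm_mult norm_power)
  define G where "G = (\<lambda>z. (\<Sum>j<k. B (w ^ j * z)) / k)"
  define FG where "FG = fps_const (1 / of_nat k) * (\<Sum>j<k. fps_compose F (fps_const (w ^ j) * fps_X))"
  have FGn: "fps_nth FG n = (\<Sum>j<k. (w ^ j) ^ n) * fps_nth F n / of_nat k" for n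
    by (simp add: FG_def fps_sum_nth sum_distrib_right)
  have Gexp: "G has_fps_expansion FG"
  proof -
    have "(B \<circ> (\<lambda>z. w ^ j * z)) has_fps_expansion fps_compose F (fps_const (w ^ j) * fps_X)" for j
      by (intro fps_expansion_intros exp) auto
    then have "(\<lambda>z. (1 / of_nat k) * (\<Sum>j<k. B (w ^ j * z))) has_fps_expansion FG"
      unfolding FG_def by (intro fps_expansion_intros) (simp add: o_def)
    then show ?thesis by (simp add: G_def)
  qed
  have FG0: "fps_nth FG 0 = fps_nth F 0" and FGk: "fps_nth FG k = fps_nth F k"
  proof -
    have "(w ^ j) ^ k = 1" for j
    proof -
      have "(w ^ j) ^ k = (w ^ k) ^ j"
        by (simp add: power_mult [symmetric] mult.commute)
      also have "w ^ k = 1" using \<open>k > 0\<close> unfolding w_def Complex.DeMoivre by simp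
      finally show ?thesis by simp
    qed
    then show "fps_nth FG 0 = fps_nth F 0" "fps_nth FG k = fps_nth F k"
      using \<open>k > 0\<close> by (auto simp: FGn)
  qed
  have FGz: "fps_nth FG n = 0" if "0 < n" "n < k" for n
    using sum_root_unity_powers[OF that] by (simp add: FGn w_def)
  have Ghol: "G holomorphic_on ball 0 1"
  proof -
    have "(B \<circ> (\<lambda>z. w ^ j * z)) holomorphic_on ball 0 1" for j
      by (intro holomorphic_on_compose_gen[OF _ hol] holomorphic_intros) auto
    then show ?thesis
      unfolding G_def by (intro holomorphic_intros) (use \<open>k > 0\<close> in \<open>auto simp: o_def\<close>)
  qed
  have Gless: "norm (G z) < 1" if "z \<in> ball 0 1" for z
  proof -
    have "norm (\<Sum>j<k. B (w ^ j * z)) \<le> (\<Sum>j<k. norm (B (w ^ j * z)))"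
      by (rule norm_sum)
    also have "\<dots> < (\<Sum>j<k. 1)"
      by (rule sum_strict_mono) (use \<open>k > 0\<close> that less in auto)
    finally show ?thesis
      using \<open>k > 0\<close> by (simp add: G_def norm_divide)
  qed
  define b where "b = fps_nth F 0"
  have b_eq: "b = B 0"
    using has_fps_expansion_imp_0_eq_fps_nth_0[OF exp] by (simp add: b_def)
  have nb: "norm b < 1"
    using less by (simp add: b_eq)
  define S where "S = Moebius_function 0 b \<circ> G"
  have Shol: "S holomorphic_on ball 0 1"
    unfolding S_def
    by (rule holomorphic_on_compose_gen[OF Ghol Moebius_function_holomorphic[OF nb]])
       (use Gless in auto)
  have Sless: "norm (S z) < 1" if "z \<in> ball 0 1" for z
    unfolding S_def o_def by (intro Moebius_function_norm_lt_1 nb Gless that)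
  have Sexp: "S has_fps_expansion fps_expansion S 0"
    by (rule has_fps_expansion_fps_expansion[OF _ _ Shol]) auto
  define FS where "FS = fps_expansion S 0"
  \<comment> \<open>Clearing the denominator of the Moebius map turns its definition into an
    identity of power series.\<close>
  have "(\<lambda>z. S z * (1 - cnj b * G z)) has_fps_expansion FS * (1 - fps_const (cnj b) * FG)"
    unfolding FS_def by (intro fps_expansion_intros Sexp Gexp)
  moreover have "eventually (\<lambda>z. S z * (1 - cnj b * G z) = G z - b) (nhds 0)"
  proof -
    have "eventually (\<lambda>z::complex. z \<in> ball 0 1) (nhds 0)"
      by (intro eventually_nhds_in_open) auto
    then show ?thesis
    proof eventually_elim
      case (elim z)
      have "norm (cnj b * G z) < 1"
        using mult_strict_mono'[OF nb Gless[OF elim]] by (simp add: norm_mult)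
      then have "1 - cnj b * G z \<noteq> 0" by auto
      then show ?case
        by (simp add: S_def Moebius_function_simple)
    qed
  qed
  ultimately have "(\<lambda>z. G z - b) has_fps_expansion FS * (1 - fps_const (cnj b) * FG)"
    by (subst (asm) has_fps_expansion_cong) auto
  moreover have "(\<lambda>z. G z - b) has_fps_expansion FG - fps_const b"
    by (intro fps_expansion_intros Gexp)
  ultimately have eq: "FS * (1 - fps_const (cnj b) * FG) = FG - fps_const b"
    by (rule fps_expansion_unique_complex)
  have S0: "fps_nth FS 0 = 0"
    unfolding FS_def has_fps_expansion_imp_0_eq_fps_nth_0[OF Sexp, symmetric]
    using has_fps_expansion_imp_0_eq_fps_nth_0[OF Gexp]
    by (simp add: S_def FG0 b_def Moebius_function_simple)
  have "fps_nth (FG - fps_const b) k = (\<Sum>i=0..k. fps_nth FS i * fps_nth (1 - fps_const (cnj b) * FG) (k - i))"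
    by (subst eq [symmetric]) (rule fps_mult_nth)
  \<comment> \<open>The term i = 0 vanishes because S(0) = 0, and those strictly between 0 and k
    vanish because \<open>FG\<close> has no coefficients there.\<close>
  also have "\<dots> = (\<Sum>i=0..k. if i = k then fps_nth FS k * (1 - cnj b * b) else 0)"
  proof (rule sum.cong)
    fix i assume i: "i \<in> {0..k}"
    consider "i = 0" | "0 < i" "i < k" | "i = k" using i by fastforce
    then show "fps_nth FS i * fps_nth (1 - fps_const (cnj b) * FG) (k - i) =
        (if i = k then fps_nth FS k * (1 - cnj b * b) else 0)"
      by cases (use \<open>k > 0\<close> in \<open>auto simp: S0 FG0 FGz b_def\<close>)
  qed auto
  also have "\<dots> = fps_nth FS k * (1 - cnj b * b)"
    by simp
  finally have "fps_nth F k = fps_nth FS k * (1 - cnj b * b)"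
    using \<open>k > 0\<close> by (simp add: FGk)
  also have "1 - cnj b * b = of_real (1 - (norm b)\<^sup>2)"
    by (simp add: complex_norm_square mult.commute del: of_real_power)
  finally have "norm (fps_nth F k) = norm (fps_nth FS k) * \<bar>1 - (norm b)\<^sup>2\<bar>"
    by (simp only: norm_mult norm_of_real)
  also have "\<dots> \<le> 1 * \<bar>1 - (norm b)\<^sup>2\<bar>"
    by (intro mult_right_mono fps_nth_bounded_le_1[OF Shol _ Sexp[folded FS_def]])
       (use Sless in \<open>auto intro: less_imp_le\<close>)
  also have "\<bar>1 - (norm b)\<^sup>2\<bar> = 1 - (norm b)\<^sup>2"
    using nb by (simp add: abs_square_le_1)
  finally show ?thesis by (simp add: b_def)
qed

text \<open>The Moebius map requires |B(0)| < 1, which fails for unimodular constants, and these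
  occur in the extremal case. The strict version is therefore applied to r B with r < 1, and r tends
  to 1.\<close>

lemma fps_nth_bounded_le:
  assumes hol: "B holomorphic_on ball 0 1" and le: "\<And>z. z \<in> ball 0 1 \<Longrightarrow> norm (B z) \<le> 1"
    and exp: "B has_fps_expansion F" and "k > 0"
  shows "norm (fps_nth F k) \<le> 1 - (norm (fps_nth F 0))\<^sup>2"
proof -
  have bound: "r * norm (fps_nth F k) \<le> 1 - (r * norm (fps_nth F 0))\<^sup>2" if r: "0 < r" "r < 1" for r :: real
  proof -
    have "norm (of_real r * B z) < 1" if "z \<in> ball 0 1" for z
    proof -
      have "norm (of_real r * B z) \<le> r * 1"
        using le[OF that] r by (simp add: norm_mult)
      with r show ?thesis by simp
    qed
    then have "norm (fps_nth (fps_const (of_real r) * F) k) \<le> 1 - (norm (fps_nth (fps_const (of_real r) * F) 0))\<^sup>2"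
      by (intro fps_nth_strictly_bounded_le[where B = "\<lambda>z. of_real r * B z"]
            fps_expansion_intros holomorphic_intros hol exp \<open>k > 0\<close>) auto
    with r show ?thesis by (simp add: norm_mult)
  qed
  have "((\<lambda>r::real. r * norm (fps_nth F k)) \<longlongrightarrow> 1 * norm (fps_nth F k)) (at_left 1)"
    "((\<lambda>r::real. 1 - (r * norm (fps_nth F 0))\<^sup>2) \<longlongrightarrow> 1 - (1 * norm (fps_nth F 0))\<^sup>2) (at_left 1)"
    by (intro tendsto_intros)+
  moreover have "eventually (\<lambda>r. r * norm (fps_nth F k) \<le> 1 - (r * norm (fps_nth F 0))\<^sup>2) (at_left (1::real))"
    using eventually_at_left_real[of 0 "1::real"] by (auto elim!: eventually_mono intro!: bound)
  ultimately show ?thesis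
    using tendsto_le trivial_limit_at_left_real by fastforce
qed

subsection \<open>Representation of the class\<close>

text \<open>Schwarz's lemma is used for V and again for h = V / z. The second use needs |h| < 1
  strictly: equality |V z| = |z| at some z other than 0 would make V a rotation, against V'(0) =
  0.\<close>

lemma Schwarz_double_zero:
  assumes hol: "V holomorphic_on ball 0 1" and "V 0 = 0" "deriv V 0 = 0"
    and less: "\<And>z. norm z < 1 \<Longrightarrow> norm (V z) < 1"
  obtains W where "W holomorphic_on ball 0 1"
    "\<And>z. norm z < 1 \<Longrightarrow> V z = z\<^sup>2 * W z" "\<And>z. norm z < 1 \<Longrightarrow> norm (W z) \<le> 1"
proof -
  obtain h where h: "h holomorphic_on ball 0 1" "\<And>z. norm z < 1 \<Longrightarrow> V z = z * h z" "h 0 = 0"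
    using Schwarz3[OF hol \<open>V 0 = 0\<close>] \<open>deriv V 0 = 0\<close> by metis
  have h_less: "norm (h z) < 1" if z: "norm z < 1" for z
  proof (cases "z = 0")
    case False
    have "norm (V z) \<le> norm z"
      by (rule Schwarz_Lemma(1)[OF hol \<open>V 0 = 0\<close> less z])
    moreover have "norm (V z) \<noteq> norm z"
    proof
      assume "norm (V z) = norm z"
      then obtain a where a: "\<And>w. norm w < 1 \<Longrightarrow> V w = a * w" "norm a = 1"
        using Schwarz_Lemma(3)[OF hol \<open>V 0 = 0\<close> less z] z False by blast
      have "eventually (\<lambda>w::complex. w \<in> ball 0 1) (nhds 0)"
        by (intro eventually_nhds_in_open) auto
      then have "eventually (\<lambda>w. V w = a * w) (nhds 0)"
        by eventually_elim (auto intro: a)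
      then have "deriv V 0 = deriv (\<lambda>w. a * w) 0"
        by (intro deriv_cong_ev) auto
      with a \<open>deriv V 0 = 0\<close> show False by simp
    qed
    ultimately have "norm z * norm (h z) < norm z * 1"
      using h(2)[OF z] by (simp add: norm_mult)
    with False show ?thesis by simp
  qed (use h in auto)
  obtain W where W: "W holomorphic_on ball 0 1" "\<And>z. norm z < 1 \<Longrightarrow> h z = z * W z" "deriv h 0 = W 0"
    using Schwarz3[OF h(1,3)] by metis
  have "norm (W z) \<le> 1" if z: "norm z < 1" for z
  proof (cases "z = 0")
    case True
    then show ?thesis
      using Schwarz_Lemma(2)[OF h(1,3) h_less z] W(3) by simp
  next
    case False
    have "norm z * norm (W z) \<le> norm z * 1"
      using Schwarz_Lemma(1)[OF h(1,3) h_less z] W(2)[OF z] by (simp add: norm_mult)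
    with False show ?thesis by simp
  qed
  with W h that[of W] show ?thesis
    by (simp add: power2_eq_square mult.assoc)
qed

lemma class_A_meromorphic:
  assumes "0 < p" "p < 1" "f \<in> class_A p"
  shows "f meromorphic_on ball 0 1"
  unfolding meromorphic_on_altdef
proof
  fix z :: complex assume z: "z \<in> ball 0 1"
  have ana: "f analytic_on (ball 0 1 - {of_real p})" and pole: "is_pole f (of_real p)"
    using assms by (auto simp: class_A_def)
  show "isolated_singularity_at f z \<and> not_essential f z"
  proof (cases "z = of_real p")
    case True
    have "isolated_singularity_at f (of_real p)"
      by (rule isolated_singularity_at_holomorphic[OF analytic_imp_holomorphic[OF ana]])
         (use assms in auto)
    with pole True show ?thesis
      by (auto simp: not_essential_def)
  next
    case False
    then have "f analytic_on {z}"
      using ana z by (auto intro: analytic_on_subset)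
    then show ?thesis
      by (simp add: isolated_singularity_at_analytic not_essential_analytic)
  qed
qed

lemma class_A_analytic_at:
  assumes "f \<in> class_A p" "norm z < 1" "z \<noteq> of_real p"
  shows "f analytic_on {z}"
  using assms by (auto simp: class_A_def intro: analytic_on_subset)

text \<open>After \<open>remove_sings\<close> only genuine poles can remain, and near a pole the
  bound |U_f| < lam would fail.\<close>

lemma U_op_analytic:
  assumes "0 < p" "p < 1" "f \<in> class_V p lam"
  shows "U_op f analytic_on ball 0 1"
proof (rule nicely_meromorphic_without_singularities)
  have "f meromorphic_on ball 0 1"
    using class_A_meromorphic assms by (auto simp: class_V_def)
  then show "U_op f nicely_meromorphic_on ball 0 1"
    unfolding U_op_def by (intro remove_sings_nicely_meromorphic meromorphic_intros) auto
  show "\<forall>z\<in>ball 0 1. \<not> is_pole (U_op f) z"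
  proof (intro ballI notI)
    fix z :: complex assume z: "z \<in> ball 0 1" and "is_pole (U_op f) z"
    then have "eventually (\<lambda>w. norm (U_op f w) \<ge> lam) (at z)"
      by (simp add: is_pole_def filterlim_at_infinity_conv_norm_at_top filterlim_at_top)
    moreover have "eventually (\<lambda>w. w \<in> ball 0 1) (at z)"
      using z eventually_at_in_open' by blast
    ultimately have "eventually (\<lambda>w. False) (at z)"
    proof eventually_elim
      case (elim w)
      then have "norm (U_op f w) < lam"
        using assms(3) by (auto simp: class_V_def)
      with elim show ?case by simp
    qed
    then show False by simp
  qed
qed

lemma U_op_eq:
  assumes "f \<in> class_A p" "norm z < 1" "z \<noteq> of_real p" "f z \<noteq> 0"
  shows "U_op f z = (z / f z)\<^sup>2 * deriv f z - 1"
  unfolding U_op_def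
  by (intro remove_sings_at_analytic analytic_intros class_A_analytic_at[of f p])
     (use assms in auto)

text \<open>The disc without p is connected, so by the identity theorem local vanishing would spread
  to a neighbourhood of 0, where f' = 1.\<close>

lemma class_A_not_eventually_zero:
  assumes "0 < p" "f \<in> class_A p" "norm z < 1" "z \<noteq> of_real p"
  shows "\<not> eventually (\<lambda>w. f w = 0) (nhds z)"
proof
  assume "eventually (\<lambda>w. f w = 0) (nhds z)"
  then obtain T where T: "open T" "z \<in> T" "\<And>w. w \<in> T \<Longrightarrow> f w = 0"
    by (auto simp: eventually_nhds)
  let ?D = "ball 0 1 - {complex_of_real p}"
  have hol: "f holomorphic_on ?D"
    using assms by (auto simp: class_A_def intro: analytic_imp_holomorphic)
  have "f w = 0" if "w \<in> ?D" for w
  proof (rule analytic_continuation_open[where s = "T \<inter> ?D" and s' = ?D and f = f and g = "\<lambda>_. 0"])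
    show "connected ?D"
      by (intro connected_open_delete) auto
    show "open (T \<inter> ?D)"
      using T by (intro open_Int open_delete) auto
  qed (use T hol assms that in \<open>auto intro!: open_delete\<close>)
  moreover have "eventually (\<lambda>w. w \<in> ?D) (nhds 0)"
    using assms by (intro eventually_nhds_in_open open_delete) auto
  ultimately have "eventually (\<lambda>w. f w = 0) (nhds 0)"
    by (auto elim: eventually_mono)
  then have "deriv f 0 = deriv (\<lambda>_. 0) 0"
    by (intro deriv_cong_ev) auto
  with assms show False
    by (simp add: class_A_def)
qed

text \<open>At a zero of \<open>f\<close> the derivative \<open>- (1 + U\<^sub>f) / z\<^sup>2\<close> of \<open>1 / f\<close> would have a pole, whereas \<open>U\<^sub>f\<close> is
  analytic there.\<close>
lemma class_V_nonzero:
  assumes "0 < p" "p < 1" "f \<in> class_V p lam" "norm z < 1" "z \<noteq> 0" "z \<noteq> of_real p"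
  shows "f z \<noteq> 0"
proof
  assume "f z = 0"
  have A: "f \<in> class_A p" using assms by (auto simp: class_V_def)
  note fz = class_A_analytic_at[OF A assms(4,6)]
  have "isolated_zero f z"
    using non_isolated_zero_imp_eventually_zero'[OF fz \<open>f z = 0\<close>]
      class_A_not_eventually_zero[OF assms(1) A assms(4,6)] by blast
  then have "is_pole (\<lambda>w. inverse (f w)) z"
    by (rule isolated_zero_imp_pole_inverse)
  moreover from \<open>isolated_zero f z\<close> have "eventually (\<lambda>w. f w \<noteq> 0) (at z)"
    by (simp add: isolated_zero_def)
  moreover have "eventually (\<lambda>w. w \<in> ball 0 1 - {0, of_real p}) (at z)"
    by (intro eventually_at_in_open' open_Diff) (use assms in auto)
  ultimately have "eventually (\<lambda>w. f w \<noteq> 0 \<and> w \<in> ball 0 1 - {0, of_real p}) (at z)"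
    by (intro eventually_conj)
  then obtain T where T: "open T" "z \<in> T" "\<And>w. w \<in> T - {z} \<Longrightarrow> f w \<noteq> 0 \<and> w \<in> ball 0 1 - {0, of_real p}"
    by (auto simp: eventually_at_topological)
  have "is_pole (\<lambda>w. - (1 + U_op f w) / w\<^sup>2) z"
  proof (rule is_pole_deriv'[OF \<open>is_pole (\<lambda>w. inverse (f w)) z\<close> T(1,2)])
    fix w assume w: "w \<in> T - {z}"
    note Tw = T(3)[OF w]
    have "(f has_field_derivative deriv f w) (at w)"
      using Tw by (intro analytic_derivI class_A_analytic_at[OF A]) auto
    moreover have "U_op f w = (w / f w)\<^sup>2 * deriv f w - 1"
      using Tw by (intro U_op_eq[OF A]) auto
    ultimately show "((\<lambda>w. inverse (f w)) has_field_derivative - (1 + U_op f w) / w\<^sup>2) (at w)"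
      using Tw by (auto intro!: derivative_eq_intros simp: field_simps power2_eq_square)
  qed
  moreover have "U_op f analytic_on {z}"
    using U_op_analytic[OF assms(1-3)] assms(4) by (auto intro: analytic_on_subset)
  then have "(\<lambda>w. - (1 + U_op f w) / w\<^sup>2) analytic_on {z}"
    by (intro analytic_intros) (use assms in auto)
  ultimately show False
    using analytic_at_imp_no_pole by blast
qed

text \<open>The relation f^2 (1 + U_f) = z^2 f' is free of quotients and holds at 0 too. Its z^2
  coefficient gives U_f(0) = 0; in the z^3 coefficient 2 a_2 appears on both sides and cancels,
  leaving U_f'(0) = 0.\<close>

lemma U_op_double_zero:
  assumes "0 < p" "p < 1" "f \<in> class_V p lam"
  shows "U_op f 0 = 0" "deriv (U_op f) 0 = 0"
proof -
  have A: "f \<in> class_A p" using assms by (auto simp: class_V_def)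
  define F where "F = fps_expansion f 0"
  define G where "G = fps_expansion (U_op f) 0"
  have F: "f has_fps_expansion F"
    unfolding F_def using assms class_A_analytic_at[OF A, of 0]
    by (intro analytic_at_imp_has_fps_expansion_0) auto
  have G: "U_op f has_fps_expansion G"
    unfolding G_def using U_op_analytic[OF assms]
    by (intro analytic_at_imp_has_fps_expansion_0) (auto intro: analytic_on_subset)
  have "eventually (\<lambda>z. z \<in> ball 0 1 - {of_real p}) (nhds 0)"
    by (intro eventually_nhds_in_open open_delete) (use assms in auto)
  then have ev: "eventually (\<lambda>z. (f z)\<^sup>2 * (1 + U_op f z) = z\<^sup>2 * deriv f z) (nhds 0)"
  proof eventually_elim
    case (elim z)
    show ?case
    proof (cases "z = 0")
      case True
      then show ?thesis using A by (simp add: class_A_def)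
    next
      case False
      with elim have "f z \<noteq> 0"
        by (intro class_V_nonzero[OF assms]) auto
      moreover have "U_op f z = (z / f z)\<^sup>2 * deriv f z - 1"
        using elim \<open>f z \<noteq> 0\<close> by (intro U_op_eq[OF A]) auto
      ultimately show ?thesis
        by (simp add: power_divide)
    qed
  qed
  have "(\<lambda>z. (f z)\<^sup>2 * (1 + U_op f z)) has_fps_expansion F\<^sup>2 * (1 + G)"
    by (intro fps_expansion_intros F G)
  moreover have "(\<lambda>z. z\<^sup>2 * deriv f z) has_fps_expansion fps_X\<^sup>2 * fps_deriv F"
    by (intro fps_expansion_intros F)
  then have "(\<lambda>z. (f z)\<^sup>2 * (1 + U_op f z)) has_fps_expansion fps_X\<^sup>2 * fps_deriv F"
    using has_fps_expansion_cong[OF ev] by blast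
  ultimately have eq: "F\<^sup>2 * (1 + G) = fps_X\<^sup>2 * fps_deriv F"
    by (rule fps_expansion_unique_complex)
  have F0: "fps_nth F 0 = 0" and F1: "fps_nth F 1 = 1"
    using A by (simp_all add: F_def fps_expansion_def class_A_def)
  have "fps_nth (F\<^sup>2 * (1 + G)) 2 = 1" 
    unfolding eq using F1 by (simp add: fps_X_power_mult_nth)
  then have G0: "fps_nth G 0 = 0"
    using F0 F1 by (simp add: fps_mult_nth power2_eq_square numeral_2_eq_2)
  have "fps_nth (F\<^sup>2 * (1 + G)) 3 = 2 * fps_nth F 2"
    using fps_X_power_mult_nth[of 2 "fps_deriv F" 3] unfolding eq by (simp add: numeral_2_eq_2)
  then have G1: "fps_nth G 1 = 0"
    using F0 F1 G0 by (simp add: fps_mult_nth power2_eq_square numeral_2_eq_2 numeral_3_eq_3)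
  show "U_op f 0 = 0" "deriv (U_op f) 0 = 0"
    using G0 G1 by (simp_all add: G_def fps_expansion_def)
qed

lemma class_V_representation:
  assumes "0 < p" "p < 1" "0 < lam" "f \<in> class_V p lam"
  obtains B where "B holomorphic_on ball 0 1" "\<And>z. z \<in> ball 0 1 \<Longrightarrow> norm (B z) \<le> 1"
    "eventually (\<lambda>z. f z * ((1 - z / of_real p) * (1 - of_real (lam * p) * z * B z)) = z) (nhds 0)"
proof -
  let ?D = "ball 0 1 - {0, complex_of_real p}"
  have A: "f \<in> class_A p" using assms by (auto simp: class_V_def)
  note V = assms(1,2,4)
  have U: "U_op f holomorphic_on ball 0 1"
    using U_op_analytic[OF V] by (rule analytic_imp_holomorphic)
  obtain W where W: "W holomorphic_on ball 0 1"
    "\<And>z. norm z < 1 \<Longrightarrow> U_op f z / of_real lam = z\<^sup>2 * W z" "\<And>z. norm z < 1 \<Longrightarrow> norm (W z) \<le> 1"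
  proof (rule Schwarz_double_zero)
    show "(\<lambda>z. U_op f z / of_real lam) holomorphic_on ball 0 1"
      using \<open>0 < lam\<close> by (intro holomorphic_intros U) auto
    have "U_op f field_differentiable at 0"
      using U by (auto simp: holomorphic_on_imp_differentiable_at)
    then show "deriv (\<lambda>z. U_op f z / of_real lam) 0 = 0"
      using U_op_double_zero[OF V] by (simp add: deriv_cdivide_right)
    show "norm (U_op f z / of_real lam) < 1" if "norm z < 1" for z
      using that assms by (simp add: class_V_def norm_divide)
  qed (use U_op_double_zero[OF V] in auto)
  obtain P where P: "\<And>z. z \<in> ball 0 1 \<Longrightarrow> (P has_field_derivative W z) (at z within ball 0 1)"
    using holomorphic_convex_primitive'[OF _ _ W(1)] by auto
  then have P': "(P has_field_derivative W z) (at z)" if "norm z < 1" for z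
    using that by (metis at_within_open mem_ball_0 open_ball)
  have Phol: "P holomorphic_on ball 0 1"
    by (subst holomorphic_on_open) (simp, metis P' mem_ball_0)
  \<comment> \<open>\<open>H z / z\<close> is the candidate for 1/f: its derivative is -1/z^2 - lam
    W, and the constant is chosen so that it vanishes at p.\<close>
  define H where "H = (\<lambda>z. 1 - z / of_real p - of_real lam * z * (P z - P (of_real p)))"
  \<comment> \<open>The negated difference quotient of \<open>P\<close> based at p, completed by the
    derivative there so as to be holomorphic. Its bound is the mean value inequality on the convex
    disc; the sign makes the extremal function correspond to B = 1.\<close>
  define B where "B = (\<lambda>z. - (if z = of_real p then deriv P (of_real p)
                                else (P z - P (of_real p)) / (z - of_real p)))"
  have Bhol: "B holomorphic_on ball 0 1"
    unfolding B_def by (intro holomorphic_on_minus pole_lemma_open Phol) auto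
  have Ble: "norm (B z) \<le> 1" if z: "z \<in> ball 0 1" for z
  proof (cases "z = of_real p")
    case True
    then show ?thesis
      using z DERIV_imp_deriv[OF P'[of "of_real p"]] W(3)[of "of_real p"] by (simp add: B_def)
  next
    case False
    have "norm (P z - P (of_real p)) \<le> 1 * norm (z - of_real p)"
      by (rule field_differentiable_bound[where S = "ball 0 1" and f' = W]) (use z assms P W in auto)
    with False show ?thesis
      by (simp add: B_def norm_divide divide_simps)
  qed
  have H_eq: "H z = (1 - z / of_real p) * (1 - of_real (lam * p) * z * B z)" for z
  proof (cases "z = of_real p")
    case False
    have "(1 - z / of_real p) * (1 - of_real (lam * p) * z * B z) =
        1 - z / of_real p - (of_real (lam * p) * (1 - z / of_real p)) * (z * B z)"
      by (simp add: algebra_simps)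
    also have "of_real (lam * p) * (1 - z / of_real p) = of_real lam * (of_real p - z)"
      using assms by (simp add: field_simps)
    also have "of_real lam * (of_real p - z) * (z * B z) = of_real lam * z * ((of_real p - z) * B z)"
      by (simp only: mult_ac)
    also have "(of_real p - z) * B z = P z - P (of_real p)"
      using False by (simp add: B_def field_simps)
    finally show ?thesis by (simp add: H_def)
  qed (use assms in \<open>auto simp: H_def\<close>)
  \<comment> \<open>Both terms have the same derivative on a connected set, and both tend to 0 at p,
    so the constant is 0.\<close>
  have "(\<lambda>z. inverse (f z) - H z / z) constant_on ?D"
  proof (rule has_field_derivative_0_imp_constant_on)
    show "open ?D" by (intro open_Diff) auto
    show "connected ?D"
      by (intro connected_open_delete_finite) auto
    fix z assume z: "z \<in> ?D"
    then have fz: "f z \<noteq> 0"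
      by (intro class_V_nonzero[OF V]) auto
    have df: "(f has_field_derivative deriv f z) (at z)"
      using z by (intro analytic_derivI class_A_analytic_at[OF A]) auto
    have "U_op f z = (z / f z)\<^sup>2 * deriv f z - 1"
      using z fz by (intro U_op_eq[OF A]) auto
    moreover have "U_op f z = of_real lam * z\<^sup>2 * W z"
      using W(2)[of z] z assms by (simp add: field_simps)
    ultimately have df_eq: "deriv f z = (f z)\<^sup>2 * (1 + of_real lam * z\<^sup>2 * W z) / z\<^sup>2"
      using z fz by (simp add: field_simps)
    show "((\<lambda>z. inverse (f z) - H z / z) has_field_derivative 0) (at z)"
      unfolding H_def using z fz assms
      by (auto intro!: derivative_eq_intros df P' simp: df_eq field_simps power2_eq_square)
  qed
  then obtain c where c: "\<And>z. z \<in> ?D \<Longrightarrow> inverse (f z) - H z / z = c"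
    by (auto simp: constant_on_def)
  have evD: "eventually (\<lambda>z. z \<in> ?D) (at w)" if "norm w < 1" for w
  proof -
    \<comment> \<open>Keeping \<open>w\<close> in the set makes it an open neighbourhood of
      \<open>w\<close> even if \<open>w\<close> is 0 or p; the punctured filter then discards
      \<open>w\<close>.\<close>
    have "eventually (\<lambda>z. z \<in> ball 0 1 - ({0, of_real p} - {w})) (nhds w)"
      using that by (intro eventually_nhds_in_open open_Diff finite_imp_closed) auto
    then show ?thesis
      by (auto simp: eventually_at_filter elim: eventually_mono)
  qed
  have "((\<lambda>z. inverse (f z) - H z / z) \<longlongrightarrow> 0 - 0) (at (of_real p))"
  proof (intro tendsto_diff)
    have "is_pole f (of_real p)" using A by (simp add: class_A_def)
    then show "((\<lambda>z. inverse (f z)) \<longlongrightarrow> 0) (at (of_real p))"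
      by (simp add: is_pole_def filterlim_compose[OF tendsto_inverse_0])
    have "isCont P (of_real p)"
      using P'[of "of_real p"] assms by (auto intro: DERIV_isCont)
    then have "isCont (\<lambda>z. H z / z) (of_real p)"
      unfolding H_def using assms by (intro continuous_intros) auto
    moreover have "H (of_real p) = 0" using assms by (simp add: H_def)
    ultimately show "((\<lambda>z. H z / z) \<longlongrightarrow> 0) (at (of_real p))"
      by (simp add: isCont_def)
  qed
  moreover have "eventually (\<lambda>z. inverse (f z) - H z / z = c) (at (of_real p))"
    using assms by (intro eventually_mono[OF evD[of "of_real p"] c]) auto
  then have "((\<lambda>z. inverse (f z) - H z / z) \<longlongrightarrow> c) (at (of_real p))"
    by (rule tendsto_eventually)
  ultimately have "c = 0"
    using tendsto_unique[OF trivial_limit_at] by fastforce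
  have "f z * H z = z" if "z \<in> ?D" for z
    using c[OF that] class_V_nonzero[OF V, of z] that \<open>c = 0\<close> by (auto simp: field_simps)
  then have "eventually (\<lambda>z. f z * H z = z) (at 0)"
    using evD[of 0] by (auto elim: eventually_mono)
  moreover have "f 0 * H 0 = 0"
    using A by (simp add: class_A_def)
  ultimately have "eventually (\<lambda>z. f z * H z = z) (nhds 0)"
    by (simp add: eventually_nhds_conv_at)
  with Bhol Ble H_eq that show ?thesis by simp
qed

subsection \<open>Coefficient formulas and majorants\<close>

text \<open>For E = F (1 - q X) the identity reads E = X + m X G E, which determines the
  coefficients of E recursively; F is recovered from F_(n+1) = E_(n+1) + q F_n. The result stays
  grouped by powers of q, because the triangle inequality is later applied group by group.\<close>

lemma fps_nth_of_factorization:
  fixes q m :: complex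
  assumes f: "f has_fps_expansion F" and B: "B has_fps_expansion G"
    and ev: "eventually (\<lambda>z. f z * ((1 - q * z) * (1 - m * z * B z)) = z) (nhds 0)"
  defines "b \<equiv> fps_nth G"
  shows "fps_nth F 3 = q\<^sup>2 + q * (m * b 0) + (m\<^sup>2 * b 0 ^ 2 + m * b 1)"
    and "fps_nth F 4 = q^3 + q\<^sup>2 * (m * b 0) + q * (m\<^sup>2 * b 0 ^ 2 + m * b 1)
           + (m^3 * b 0 ^ 3 + 2 * m\<^sup>2 * b 0 * b 1 + m * b 2)"
    and "fps_nth F 5 = q^4 + q^3 * (m * b 0) + q\<^sup>2 * (m\<^sup>2 * b 0 ^ 2 + m * b 1)
           + q * (m^3 * b 0 ^ 3 + 2 * m\<^sup>2 * b 0 * b 1 + m * b 2)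
           + (m^4 * b 0 ^ 4 + 3 * m^3 * b 0 ^ 2 * b 1 + m\<^sup>2 * (2 * b 0 * b 2 + b 1 ^ 2) + m * b 3)"
proof -
  define E where "E = F * (1 - fps_const q * fps_X)"
  have "(\<lambda>z. f z * ((1 - q * z) * (1 - m * z * B z))) has_fps_expansion
      F * ((1 - fps_const q * fps_X) * (1 - fps_const m * fps_X * G))"
    by (intro fps_expansion_intros f B)
  then have "(\<lambda>z. z) has_fps_expansion F * ((1 - fps_const q * fps_X) * (1 - fps_const m * fps_X * G))"
    using has_fps_expansion_cong[OF ev] by blast
  then have "F * ((1 - fps_const q * fps_X) * (1 - fps_const m * fps_X * G)) = fps_X"
    using has_fps_expansion_fps_X by (rule fps_expansion_unique_complex)
  then have "E = fps_X + fps_const m * (fps_X * (G * E))"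
    by (simp add: E_def algebra_simps)
  then have E: "fps_nth E n = fps_nth (fps_X + fps_const m * (fps_X * (G * E))) n" for n
    by simp
  have E0: "fps_nth E 0 = 0"
    by (subst E) simp
  have ES: "fps_nth E (Suc n) = (if n = 0 then 1 else 0) + m * (\<Sum>i=0..n. b i * fps_nth E (n - i))" for n
    by (subst E) (simp add: fps_mult_nth[of G E] b_def)
  have F0: "fps_nth F 0 = 0"
    using E0 by (simp add: E_def)
  have "fps_nth E (Suc n) = fps_nth F (Suc n) - q * fps_nth F n" for n
    by (simp add: E_def right_diff_distrib mult.left_commute[of F] fps_mult_fps_X_commute)
  then have FS: "fps_nth F (Suc n) = fps_nth E (Suc n) + q * fps_nth F n" for n
    by simp
  have E1: "fps_nth E (Suc 0) = 1"
    by (simp add: ES E0)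
  have E2: "fps_nth E (Suc (Suc 0)) = m * b 0"
    by (subst ES) (simp add: E0 E1)
  have E3: "fps_nth E (Suc (Suc (Suc 0))) = m\<^sup>2 * b 0 ^ 2 + m * b 1"
    by (subst ES) (simp add: E0 E1 E2 algebra_simps power2_eq_square)
  have E4: "fps_nth E (Suc (Suc (Suc (Suc 0)))) = m^3 * b 0 ^ 3 + 2 * m\<^sup>2 * b 0 * b 1 + m * b 2"
    by (subst ES) (simp add: E0 E1 E2 E3 algebra_simps eval_nat_numeral)
  have E5: "fps_nth E (Suc (Suc (Suc (Suc (Suc 0))))) =
      m^4 * b 0 ^ 4 + 3 * m^3 * b 0 ^ 2 * b 1 + m\<^sup>2 * (2 * b 0 * b 2 + b 1 ^ 2) + m * b 3"
    by (subst ES) (simp add: E0 E1 E2 E3 E4 algebra_simps eval_nat_numeral)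
  note F1 = FS[of 0, unfolded E1 F0, simplified]
  note F2 = FS[of "Suc 0", unfolded E2 F1, simplified]
  note F3 = FS[of "Suc (Suc 0)", unfolded E3 F2, simplified]
  note F4 = FS[of "Suc (Suc (Suc 0))", unfolded E4 F3, simplified]
  note F5 = FS[of "Suc (Suc (Suc (Suc 0)))", unfolded E5 F4, simplified]
  have Suc_eq: "Suc (Suc (Suc 0)) = 3" "Suc (Suc (Suc (Suc 0))) = 4" "Suc (Suc (Suc (Suc (Suc 0)))) = 5"
    by simp_all
  show "fps_nth F 3 = q\<^sup>2 + q * (m * b 0) + (m\<^sup>2 * b 0 ^ 2 + m * b 1)"
    using F3 unfolding Suc_eq by (simp add: algebra_simps power2_eq_square)
  show "fps_nth F 4 = q^3 + q\<^sup>2 * (m * b 0) + q * (m\<^sup>2 * b 0 ^ 2 + m * b 1)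
           + (m^3 * b 0 ^ 3 + 2 * m\<^sup>2 * b 0 * b 1 + m * b 2)"
    using F4 unfolding Suc_eq by (simp add: algebra_simps power2_eq_square power3_eq_cube)
  show "fps_nth F 5 = q^4 + q^3 * (m * b 0) + q\<^sup>2 * (m\<^sup>2 * b 0 ^ 2 + m * b 1)
           + q * (m^3 * b 0 ^ 3 + 2 * m\<^sup>2 * b 0 * b 1 + m * b 2)
           + (m^4 * b 0 ^ 4 + 3 * m^3 * b 0 ^ 2 * b 1 + m\<^sup>2 * (2 * b 0 * b 2 + b 1 ^ 2) + m * b 3)"
    using F5 unfolding Suc_eq
    by (simp add: algebra_simps power2_eq_square power3_eq_cube power4_eq_xxxx)
qed

text \<open>Here q stands for 1/p, m for lam p, x for |b_0|, and y bounds the later coefficients of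
  B. The right side is the left side at x = 1, and the difference is nonnegative in each power of m.
  For m itself the factor q - (1 + x) is smallest at x = 1, which is where q \<ge> 2 enters.\<close>

lemma majorant_le_3:
  fixes q m x :: real
  assumes "q \<ge> 2" "m \<ge> 0" "0 \<le> x" "x \<le> 1" "y = 1 - x\<^sup>2"
  shows "q * (m * x) + (m\<^sup>2 * x\<^sup>2 + m * y) \<le> q * m + m\<^sup>2"
proof -
  have "q * m + m\<^sup>2 - (q * (m * x) + (m\<^sup>2 * x\<^sup>2 + m * y)) =
      m * ((1 - x) * (q - (1 + x))) + m\<^sup>2 * (1 - x\<^sup>2)"
    unfolding assms(5) by (simp add: algebra_simps power2_eq_square)
  also have "\<dots> \<ge> 0"
    using assms by (intro add_nonneg_nonneg mult_nonneg_nonneg) (auto simp: power_le_one)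
  finally show ?thesis by simp
qed

text \<open>The first assumption is q^2 - (1 + x) (q + 1) \<ge> 0 at its worst point x = 1, as the
  coefficient of m demands; q \<ge> 2 handles the coefficient y (q - 2 x) of m^2.\<close>

lemma majorant_le_4:
  fixes q m x :: real
  assumes "q\<^sup>2 \<ge> 2 * q + 2" "q \<ge> 2" "m \<ge> 0" "0 \<le> x" "x \<le> 1" "y = 1 - x\<^sup>2"
  shows "q\<^sup>2 * (m * x) + q * (m\<^sup>2 * x\<^sup>2 + m * y) + (m^3 * x^3 + 2 * m\<^sup>2 * x * y + m * y)
    \<le> q\<^sup>2 * m + q * m\<^sup>2 + m^3"
proof -
  have "(1 + x) * (q + 1) \<le> 2 * (q + 1)"
    using assms by (intro mult_right_mono) auto
  then have a: "0 \<le> q\<^sup>2 - (1 + x) * (q + 1)"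
    using assms by simp
  have y: "y \<ge> 0" using assms by (simp add: power_le_one)
  have "q\<^sup>2 * m + q * m\<^sup>2 + m^3
        - (q\<^sup>2 * (m * x) + q * (m\<^sup>2 * x\<^sup>2 + m * y) + (m^3 * x^3 + 2 * m\<^sup>2 * x * y + m * y)) =
      m * ((1 - x) * (q\<^sup>2 - (1 + x) * (q + 1))) + m\<^sup>2 * (y * (q - 2 * x)) + m^3 * (1 - x^3)"
    unfolding assms(6) by (simp add: algebra_simps power2_eq_square power3_eq_cube)
  also have "\<dots> \<ge> 0"
    using assms a y by (intro add_nonneg_nonneg mult_nonneg_nonneg) (auto simp: power_le_one)
  finally show ?thesis by simp
qed

text \<open>The facts \<open>a\<close>, \<open>b\<close>, \<open>c\<close> serve the powers m, m^2,
  m^3. For \<open>a\<close>, multiplying the first assumption by q gives q^3 \<ge> 2 q^2 + 4 q \<ge>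
  2 (q^2 + q + 1); \<open>b\<close> uses 2 x q + 2 x + y \<le> 2 q + 3; \<open>c\<close> rests on q
  \<ge> 3 and x^3 \<le> x.\<close>

lemma majorant_le_5:
  fixes q m x :: real
  assumes "q\<^sup>2 \<ge> 2 * q + 4" "q \<ge> 3" "m \<ge> 0" "0 \<le> x" "x \<le> 1" "y = 1 - x\<^sup>2"
  shows "q^3 * (m * x) + q\<^sup>2 * (m\<^sup>2 * x\<^sup>2 + m * y) + q * (m^3 * x^3 + 2 * m\<^sup>2 * x * y + m * y)
      + (m^4 * x^4 + 3 * m^3 * x\<^sup>2 * y + m\<^sup>2 * (2 * x * y + y\<^sup>2) + m * y)
    \<le> q^3 * m + q\<^sup>2 * m\<^sup>2 + q * m^3 + m^4"
proof -
  have y: "0 \<le> y" "y \<le> 1" using assms by (simp_all add: power_le_one)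
  have "q * (2 * q + 4) \<le> q * q\<^sup>2"
    using assms by (intro mult_left_mono) auto
  moreover have "(1 + x) * (q\<^sup>2 + q + 1) \<le> 2 * (q\<^sup>2 + q + 1)"
    using assms by (intro mult_right_mono) auto
  ultimately have a: "0 \<le> q^3 - (1 + x) * (q\<^sup>2 + q + 1)"
    using assms(2) by (simp add: algebra_simps power2_eq_square power3_eq_cube)
  have "x * q \<le> 1 * q"
    using assms by (intro mult_right_mono) auto
  then have b: "0 \<le> q\<^sup>2 - 2 * x * q - 2 * x - y"
    using assms(1,5) y by simp
  have "(1 + x + x\<^sup>2) * 3 \<le> (1 + x + x\<^sup>2) * q"
    using assms by (intro mult_left_mono) auto
  moreover have "x\<^sup>2 * x \<le> 1 * x"
    using assms by (intro mult_right_mono) (auto simp: power_le_one)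
  ultimately have c: "0 \<le> (1 + x + x\<^sup>2) * q - 3 * x\<^sup>2 * (1 + x)"
    by (simp add: algebra_simps power2_eq_square)
  have "q^3 * m + q\<^sup>2 * m\<^sup>2 + q * m^3 + m^4
      - (q^3 * (m * x) + q\<^sup>2 * (m\<^sup>2 * x\<^sup>2 + m * y) + q * (m^3 * x^3 + 2 * m\<^sup>2 * x * y + m * y)
      + (m^4 * x^4 + 3 * m^3 * x\<^sup>2 * y + m\<^sup>2 * (2 * x * y + y\<^sup>2) + m * y)) =
      m * ((1 - x) * (q^3 - (1 + x) * (q\<^sup>2 + q + 1)))
      + m\<^sup>2 * (y * (q\<^sup>2 - 2 * x * q - 2 * x - y))
      + m^3 * ((1 - x) * ((1 + x + x\<^sup>2) * q - 3 * x\<^sup>2 * (1 + x))) + m^4 * (1 - x^4)"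
    unfolding assms(6) by (simp add: algebra_simps power2_eq_square power3_eq_cube power4_eq_xxxx)
  also have "\<dots> \<ge> 0"
    using assms(3,4,5) a b c y by (intro add_nonneg_nonneg mult_nonneg_nonneg) (auto simp: power_le_one)
  finally show ?thesis by simp
qed

lemma coeff_bound_eq_sum:
  assumes "lam * p\<^sup>2 \<noteq> 1"
  shows "coeff_bound p lam n = (\<Sum>k<n. (lam * p\<^sup>2) ^ k) / p ^ (n - 1)"
  using assms by (simp add: coeff_bound_def sum_gp_strict)

lemma coeff_bound_numeral:
  assumes "p \<noteq> 0" "lam * p\<^sup>2 \<noteq> 1"
  defines "q \<equiv> 1 / p" and "m \<equiv> lam * p"
  shows "coeff_bound p lam 3 = q\<^sup>2 + (q * m + m\<^sup>2)"
    and "coeff_bound p lam 4 = q^3 + (q\<^sup>2 * m + q * m\<^sup>2 + m^3)"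
    and "coeff_bound p lam 5 = q^4 + (q^3 * m + q\<^sup>2 * m\<^sup>2 + q * m^3 + m^4)"
  using assms
  by (simp_all add: coeff_bound_eq_sum eval_nat_numeral lessThan_Suc field_simps)

text \<open>The bound on p is the positive root of 2 p^2 + 2 p = 1; completing the square gives (2 p
  + 1)^2 \<le> 3.\<close>

lemma threshold_4:
  fixes p :: real
  assumes "0 < p" "p \<le> (sqrt 3 - 1) / 2"
  shows "(1 / p)\<^sup>2 \<ge> 2 * (1 / p) + 2"
proof -
  have "(2 * p + 1)\<^sup>2 \<le> (sqrt 3)\<^sup>2"
    using assms by (intro power_mono) auto
  then have "0 \<le> (1 - 2 * p\<^sup>2 - 2 * p) / p\<^sup>2"
    by (simp add: power2_eq_square algebra_simps)
  also have "\<dots> = (1 / p)\<^sup>2 - (2 * (1 / p) + 2)"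
    using \<open>0 < p\<close> by (simp add: field_simps power2_eq_square)
  finally show ?thesis by simp
qed

text \<open>The bound on p is the positive root of 4 p^2 + 2 p = 1, that is, of (4 p + 1)^2 =
  5.\<close>

lemma threshold_5:
  fixes p :: real
  assumes "0 < p" "p \<le> (sqrt 5 - 1) / 4"
  shows "(1 / p)\<^sup>2 \<ge> 2 * (1 / p) + 4"
proof -
  have "(4 * p + 1)\<^sup>2 \<le> (sqrt 5)\<^sup>2"
    using assms by (intro power_mono) auto
  then have "0 \<le> (1 - 4 * p\<^sup>2 - 2 * p) / p\<^sup>2"
    by (simp add: power2_eq_square algebra_simps)
  also have "\<dots> = (1 / p)\<^sup>2 - (2 * (1 / p) + 4)"
    using \<open>0 < p\<close> by (simp add: field_simps power2_eq_square)
  finally show ?thesis by simp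
qed

subsection \<open>The extremal function\<close>

text \<open>The shape of the representation with B = 1. Where a denominator vanishes, both sides are
  0 by the convention for division.\<close>

lemma k_fun_eq:
  assumes "p \<noteq> 0"
  shows "k_fun p lam z = z / ((1 - z / of_real p) * (1 - of_real lam * of_real p * z))"
  using assms by (simp add: k_fun_def divide_simps) (simp add: algebra_simps)

lemma k_fun_denominator_nonzero:
  assumes "0 < p" "p < 1" "0 < lam" "lam \<le> 1" "norm z < 1"
  shows "1 - complex_of_real lam * of_real p * z \<noteq> 0"
proof
  assume "1 - complex_of_real lam * of_real p * z = 0"
  then have "norm (of_real lam * of_real p * z) = 1"
    by simp
  then have "lam * p * norm z = 1"
    using assms by (simp add: norm_mult)
  moreover have "lam * p \<le> 1 * 1"
    using assms by (intro mult_mono) auto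
  then have "lam * p * norm z \<le> 1 * norm z"
    by (intro mult_right_mono) auto
  ultimately show False
    using assms by simp
qed

lemma k_fun_has_field_derivative:
  assumes "0 < p" "p < 1" "0 < lam" "lam \<le> 1" "norm z < 1" "z \<noteq> of_real p"
  shows "(k_fun p lam has_field_derivative
    (1 - of_real lam * z\<^sup>2) / ((1 - z / of_real p) * (1 - of_real lam * of_real p * z))\<^sup>2) (at z)"
proof -
  define h :: "complex \<Rightarrow> complex" where "h z = (1 - z / of_real p) * (1 - of_real lam * of_real p * z)" for z
  have "h z \<noteq> 0"
    using k_fun_denominator_nonzero[OF assms(1-5)] assms by (simp add: h_def)
  have "(h has_field_derivative
      (- 1 / of_real p * (1 - of_real lam * of_real p * z) + (1 - z / of_real p) * (- of_real lam * of_real p))) (at z)"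
    unfolding h_def using assms by (auto intro!: derivative_eq_intros)
  then have "((\<lambda>z. z / h z) has_field_derivative
      (h z - z * (- 1 / of_real p * (1 - of_real lam * of_real p * z) + (1 - z / of_real p) * (- of_real lam * of_real p)))
      / (h z)\<^sup>2) (at z)"
    using \<open>h z \<noteq> 0\<close> by (auto intro!: derivative_eq_intros simp: power2_eq_square)
  also have "h z - z * (- 1 / of_real p * (1 - of_real lam * of_real p * z) + (1 - z / of_real p) * (- of_real lam * of_real p)) =
      1 - of_real lam * z\<^sup>2"
    using assms by (simp add: h_def field_simps power2_eq_square)
  also have "(\<lambda>z. z / h z) = k_fun p lam"
    using assms by (simp add: h_def k_fun_eq fun_eq_iff)
  finally show ?thesis by (simp add: h_def)
qed

lemma k_fun_in_class_A:
  assumes "0 < p" "p < 1" "0 < lam" "lam \<le> 1"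
  shows "k_fun p lam \<in> class_A p"
proof -
  let ?g = "\<lambda>z. - complex_of_real p * z / (1 - of_real lam * of_real p * z)"
  note nz = k_fun_denominator_nonzero[OF assms]
  have g: "?g holomorphic_on ball 0 1"
    by (intro holomorphic_intros) (use nz in auto)
  have gp: "?g (of_real p) \<noteq> 0"
    using nz[of "of_real p"] assms by simp
  have k: "k_fun p lam = (\<lambda>z. ?g z / (z - of_real p) ^ 1)"
    by (simp add: k_fun_def fun_eq_iff mult.commute)
  have "is_pole (k_fun p lam) (of_real p)"
    unfolding k by (rule is_pole_basic[OF g]) (use gp assms in auto)
  moreover have "zorder (k_fun p lam) (of_real p) = -1"
    by (rule zorder_eqI[OF _ _ g gp]) (use assms in \<open>auto simp: k power_int_minus divide_inverse\<close>)
  moreover have "k_fun p lam analytic_on (ball 0 1 - {of_real p})"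
    unfolding k_fun_def by (intro analytic_intros) (use nz in auto)
  moreover have "deriv (k_fun p lam) 0 = 1"
    using DERIV_imp_deriv[OF k_fun_has_field_derivative[OF assms, of 0]] assms by simp
  ultimately show ?thesis
    by (simp add: class_A_def k_fun_def)
qed

text \<open>Away from 0 and p the squared denominators of z / k and k' cancel, leaving (1 - lam z^2)
  - 1. At these two points \<open>remove_sings\<close> takes the limit of the same
  expression.\<close>

lemma U_op_k_fun:
  assumes "0 < p" "p < 1" "0 < lam" "lam \<le> 1" "norm z < 1"
  shows "U_op (k_fun p lam) z = - of_real lam * z\<^sup>2"
proof -
  have "eventually (\<lambda>w. w \<in> ball 0 1 - ({0, of_real p} - {z})) (nhds z)"
    using assms by (intro eventually_nhds_in_open open_Diff finite_imp_closed) auto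
  then have "eventually (\<lambda>w. norm w < 1 \<and> w \<noteq> 0 \<and> w \<noteq> of_real p) (at z)"
    by (auto simp: eventually_at_filter elim: eventually_mono)
  then have "eventually (\<lambda>w. - of_real lam * w\<^sup>2 = (w / k_fun p lam w)\<^sup>2 * deriv (k_fun p lam) w - 1) (at z)"
  proof eventually_elim
    case (elim w)
    then show ?case
      using DERIV_imp_deriv[OF k_fun_has_field_derivative[OF assms(1-4), of w]]
        k_fun_denominator_nonzero[OF assms(1-4), of w] assms
      by (simp add: k_fun_eq)
  qed
  moreover have "((\<lambda>w. - of_real lam * w\<^sup>2) \<longlongrightarrow> - of_real lam * z\<^sup>2) (at z)"
    by (intro tendsto_intros)
  ultimately show ?thesis
    unfolding U_op_def by (intro remove_sings_eqI) (rule Lim_transform_eventually)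
qed

lemma k_fun_in_class_V:
  assumes "0 < p" "p < 1" "0 < lam" "lam \<le> 1"
  shows "k_fun p lam \<in> class_V p lam"
proof -
  have "norm (U_op (k_fun p lam) z) < lam" if "norm z < 1" for z
  proof -
    have "(norm z)\<^sup>2 < 1"
      using that by (simp add: abs_square_less_1)
    then show ?thesis
      using assms by (simp add: U_op_k_fun[OF assms that] norm_mult norm_power)
  qed
  with k_fun_in_class_A[OF assms] show ?thesis
    by (simp add: class_V_def)
qed

subsection \<open>The coefficient bounds\<close>

lemma mult_power2_less_1:
  fixes p lam :: real
  assumes "0 < p" "p < 1" "0 < lam" "lam \<le> 1"
  shows "lam * p\<^sup>2 < 1"
proof -
  have "lam * p\<^sup>2 \<le> 1 * p\<^sup>2"
    using assms by (intro mult_right_mono) auto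
  also have "\<dots> < 1"
    using assms by (simp add: abs_square_less_1)
  finally show ?thesis .
qed

lemma class_V_coeff_bounds:
  assumes "0 < p" "p < 1" "0 < lam" "lam \<le> 1" "f \<in> class_V p lam"
  shows "p \<le> 1 / 2 \<Longrightarrow> norm (taylor_coeff f 3) \<le> coeff_bound p lam 3"
    and "p \<le> (sqrt 3 - 1) / 2 \<Longrightarrow> norm (taylor_coeff f 4) \<le> coeff_bound p lam 4"
    and "p \<le> (sqrt 5 - 1) / 4 \<Longrightarrow> norm (taylor_coeff f 5) \<le> coeff_bound p lam 5"
proof -
  define q m where "q = 1 / p" and "m = lam * p"
  have qm: "q > 0" "m \<ge> 0" using assms by (simp_all add: q_def m_def)
  have ne: "p \<noteq> 0" "lam * p\<^sup>2 \<noteq> 1"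
    using mult_power2_less_1[OF assms(1-4)] assms by auto
  obtain B where B: "B holomorphic_on ball 0 1" "\<And>z. z \<in> ball 0 1 \<Longrightarrow> norm (B z) \<le> 1"
    "eventually (\<lambda>z. f z * ((1 - z / of_real p) * (1 - of_real (lam * p) * z * B z)) = z) (nhds 0)"
    using class_V_representation[OF assms(1,2,3,5)] by blast
  define b where "b = fps_nth (fps_expansion B 0)"
  have Bexp: "B has_fps_expansion fps_expansion B 0"
    by (rule has_fps_expansion_fps_expansion[OF _ _ B(1)]) auto
  have fexp: "f has_fps_expansion fps_expansion f 0"
    using assms by (intro analytic_at_imp_has_fps_expansion_0 class_A_analytic_at[of f p])
      (auto simp: class_V_def)
  have ev: "eventually (\<lambda>z. f z * ((1 - of_real q * z) * (1 - of_real m * z * B z)) = z) (nhds 0)"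
    using B(3) by (simp add: q_def m_def)
  note coeffs = fps_nth_of_factorization[OF fexp Bexp ev, folded b_def, folded taylor_coeff_def]
  \<comment> \<open>From here on every estimate depends on B through the single real number
    x.\<close>
  define x y where "x = norm (b 0)" and "y = 1 - x\<^sup>2"
  have x: "0 \<le> x" "x \<le> 1"
    using fps_nth_bounded_le_1[OF B(1,2) Bexp] by (simp_all add: x_def b_def)
  have y: "0 \<le> y" "y \<le> 1" using x by (simp_all add: y_def power_le_one)
  have b_le: "norm (b k) \<le> y" if "k > 0" for k
    using fps_nth_bounded_le[OF B(1,2) Bexp that] by (simp add: x_def y_def b_def)
  have nm [simp]: "norm (of_real m :: complex) = m" "norm (of_real q :: complex) = q"
    using qm by simp_all
  note tri = order.trans[OF norm_triangle_ineq add_mono]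
  note norms = norm_mult norm_power nm x_def [symmetric]
  let ?q = "complex_of_real q" and ?m = "complex_of_real m"
  have e2: "norm (?m * b 0) \<le> m * x"
    using qm by (simp add: norms)
  have e3: "norm (?m\<^sup>2 * b 0 ^ 2 + ?m * b 1) \<le> m\<^sup>2 * x\<^sup>2 + m * y"
    by (rule tri) (use qm x y b_le in \<open>auto simp: norms intro!: mult_left_mono\<close>)
  have e4: "norm (?m^3 * b 0 ^ 3 + 2 * ?m\<^sup>2 * b 0 * b 1 + ?m * b 2) \<le> m^3 * x^3 + 2 * m\<^sup>2 * x * y + m * y"
    by (intro tri) (use qm x y b_le in \<open>auto simp: norms intro!: mult_left_mono\<close>)
  have e5: "norm (?m^4 * b 0 ^ 4 + 3 * ?m^3 * b 0 ^ 2 * b 1 + ?m\<^sup>2 * (2 * b 0 * b 2 + b 1 ^ 2) + ?m * b 3)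
      \<le> m^4 * x^4 + 3 * m^3 * x\<^sup>2 * y + m\<^sup>2 * (2 * x * y + y\<^sup>2) + m * y"
  proof -
    have "norm (2 * b 0 * b 2 + b 1 ^ 2) \<le> 2 * x * y + y\<^sup>2"
      by (intro tri) (use qm x y b_le in \<open>auto simp: norms intro!: mult_left_mono power_mono\<close>)
    then show ?thesis
      by (intro tri) (use qm x y b_le in \<open>auto simp: norms intro!: mult_left_mono\<close>)
  qed
  have qmul: "norm (?q ^ n * w) \<le> q ^ n * r" if "norm w \<le> r" for n w r
    using that qm by (simp add: norms mult_left_mono)
  have qmul1: "norm (?q * w) \<le> q * r" if "norm w \<le> r" for w r
    using that qm by (simp add: norms mult_left_mono)
  have qpow: "norm (?q ^ n) \<le> q ^ n" for n
    using qm by (simp add: norms)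
  have c3: "norm (taylor_coeff f 3) \<le> q\<^sup>2 + q * (m * x) + (m\<^sup>2 * x\<^sup>2 + m * y)"
    unfolding coeffs(1) by (intro tri[OF tri e3] qpow qmul1 e2)
  have c4: "norm (taylor_coeff f 4) \<le> q^3 + q\<^sup>2 * (m * x) + q * (m\<^sup>2 * x\<^sup>2 + m * y)
      + (m^3 * x^3 + 2 * m\<^sup>2 * x * y + m * y)"
    unfolding coeffs(2) by (intro tri[OF tri[OF tri] e4] qpow qmul qmul1 e2 e3)
  have c5: "norm (taylor_coeff f 5) \<le> q^4 + q^3 * (m * x) + q\<^sup>2 * (m\<^sup>2 * x\<^sup>2 + m * y)
      + q * (m^3 * x^3 + 2 * m\<^sup>2 * x * y + m * y)
      + (m^4 * x^4 + 3 * m^3 * x\<^sup>2 * y + m\<^sup>2 * (2 * x * y + y\<^sup>2) + m * y)"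
    unfolding coeffs(3) by (intro tri[OF tri[OF tri[OF tri]] e5] qpow qmul qmul1 e2 e3 e4)
  note bounds = coeff_bound_numeral[OF ne, folded q_def m_def]
  show "norm (taylor_coeff f 3) \<le> coeff_bound p lam 3" if "p \<le> 1 / 2"
  proof -
    have "q \<ge> 2" using that assms by (simp add: q_def field_simps)
    then show ?thesis
      using c3 majorant_le_3[OF _ qm(2) x y_def, of q] by (simp add: bounds)
  qed
  show "norm (taylor_coeff f 4) \<le> coeff_bound p lam 4" if "p \<le> (sqrt 3 - 1) / 2"
  proof -
    have q2: "q\<^sup>2 \<ge> 2 * q + 2"
      using threshold_4[OF \<open>0 < p\<close> that] by (simp add: q_def)
    moreover have "q \<ge> 2"
    proof (rule ccontr)
      assume "\<not> q \<ge> 2"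
      then have "q * q \<le> 2 * q" using qm by (intro mult_right_mono) auto
      with q2 show False by (simp add: power2_eq_square)
    qed
    ultimately show ?thesis
      using c4 majorant_le_4[OF _ _ qm(2) x y_def, of q] by (simp add: bounds)
  qed
  show "norm (taylor_coeff f 5) \<le> coeff_bound p lam 5" if "p \<le> (sqrt 5 - 1) / 4"
  proof -
    have q2: "q\<^sup>2 \<ge> 2 * q + 4"
      using threshold_5[OF \<open>0 < p\<close> that] by (simp add: q_def)
    \<comment> \<open>If q < 3, then 2 q + 4 \<le> q^2 \<le> 3 q would force q \<ge> 4.\<close>
    moreover have "q \<ge> 3"
    proof (rule ccontr)
      assume "\<not> q \<ge> 3"
      then have "q * q \<le> 3 * q" using qm by (intro mult_right_mono) auto
      with q2 \<open>\<not> q \<ge> 3\<close> show False by (simp add: power2_eq_square)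
    qed
    ultimately show ?thesis
      using c5 majorant_le_5[OF _ _ qm(2) x y_def, of q] by (simp add: bounds)
  qed
qed

text \<open>With B = 1 the coefficient formulas have b_0 = 1 and all later b_k = 0, so only the
  geometric sum in q and m survives.\<close>

lemma taylor_coeff_k_fun:
  assumes "0 < p" "p < 1" "0 < lam" "lam \<le> 1" "n \<in> {3, 4, 5}"
  shows "taylor_coeff (k_fun p lam) n = of_real (coeff_bound p lam n)"
proof -
  have ne: "p \<noteq> 0" "lam * p\<^sup>2 \<noteq> 1"
    using mult_power2_less_1[OF assms(1-4)] assms by auto
  have kexp: "k_fun p lam has_fps_expansion fps_expansion (k_fun p lam) 0"
    using assms k_fun_in_class_A[OF assms(1-4)]
    by (intro analytic_at_imp_has_fps_expansion_0 class_A_analytic_at[of _ p]) auto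
  have "eventually (\<lambda>z. z \<in> ball 0 1 - {complex_of_real p}) (nhds 0)"
    by (intro eventually_nhds_in_open open_delete) (use assms in auto)
  then have ev: "eventually (\<lambda>z. k_fun p lam z * ((1 - of_real (1 / p) * z) * (1 - of_real (lam * p) * z * 1)) = z) (nhds 0)"
  proof eventually_elim
    case (elim z)
    then show ?case
      using k_fun_denominator_nonzero[OF assms(1-4), of z] assms by (simp add: k_fun_eq)
  qed
  note coeffs = fps_nth_of_factorization[OF kexp has_fps_expansion_1 ev, folded taylor_coeff_def]
  show ?thesis
    using assms(5) coeffs by (auto simp: coeff_bound_numeral[OF ne])
qed

theorem theorem2:
  fixes p lam :: real
  assumes "0 < p" "p < 1" "0 < lam" "lam \<le> 1"
  shows "k_fun p lam \<in> class_V p lam \<and>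
    (\<forall>n. (n = 3 \<and> p \<le> 1/2) \<or> (n = 4 \<and> p \<le> (sqrt 3 - 1) / 2) \<or> (n = 5 \<and> p \<le> (sqrt 5 - 1) / 4) \<longrightarrow>
       (\<forall>f\<in>class_V p lam. norm (taylor_coeff f n) \<le> coeff_bound p lam n) \<and>
       norm (taylor_coeff (k_fun p lam) n) = coeff_bound p lam n)"
proof (intro conjI allI impI ballI)
  show k: "k_fun p lam \<in> class_V p lam"
    by (rule k_fun_in_class_V[OF assms])
  fix n :: nat
  assume n: "(n = 3 \<and> p \<le> 1/2) \<or> (n = 4 \<and> p \<le> (sqrt 3 - 1) / 2) \<or> (n = 5 \<and> p \<le> (sqrt 5 - 1) / 4)"
  show le: "norm (taylor_coeff f n) \<le> coeff_bound p lam n" if "f \<in> class_V p lam" for f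
    using n class_V_coeff_bounds[OF assms that] by auto
  \<comment> \<open>The norm of a real number is its absolute value, so the sign of the bound
    matters; it follows from the inequality for \<open>k_fun\<close> itself.\<close>
  have "0 \<le> coeff_bound p lam n"
    using le[OF k] norm_ge_zero order.trans by blast
  moreover have "taylor_coeff (k_fun p lam) n = of_real (coeff_bound p lam n)"
    using n by (intro taylor_coeff_k_fun assms) auto
  ultimately show "norm (taylor_coeff (k_fun p lam) n) = coeff_bound p lam n"
    by simp
qed

end
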